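(* For every skew shape $\lambda/\mu$, the hybrid Grothendieck polynomial $G_{\lambda/\mu}(\mathbf{x};\mathbf{t};\mathbf{w})$ is symmetric in the variables $\mathbf{x}=(x_1,x_2,\ldots)$; that is, for every fixed monomial $\mathbf{t}^{\gamma}\mathbf{w}^{\theta}$, its coefficient (a formal power series in $\mathbf{x}$) is invariant under every permutation of the variables $x_1,x_2,\ldots$.
   Context: Partitions are identified with Young diagrams; boxes are written $(i,j)$ (row $i$, column $j$, matrix coordinates). For partitions $\mu\subseteq\lambda$, the skew shape $\lambda/\mu$ is the set of boxes of $\lambda$ not in $\mu$. For nonempty finite sets $A,B$ of positive integers write $A\le B$ if $\max A\le\min B$. A set-valued reverse plane partition (SVRPP) of shape $\lambda/\mu$ is a filling $T$ assigning to each box $(i,j)\in\lambda/\mu$ a nonempty finite set $T(i,j)$ of positive integers such that the sets weakly increase (in the order $\le$) from left to right along each row and from top to bottom down each column. Let $\mathrm{SVRPP}(\lambda/\mu)$ be the set of these. Statistics: $\mathrm{ircont}(T)=(r_1,r_2,\ldots)$, where $r_k$ is the number of columns of $T$ containing some box whose set contains $k$; $\mathrm{ceq}(T)=(c_1,c_2,\ldots)$, where $c_i$ is the number of boxes $(i,j)\in\lambda/\mu$ such that $(i+1,j)\in\lambda/\mu$ and $\max T(i,j)=\min T(i+1,j)$; $\mathrm{ex}(T)=(e_1,e_2,\ldots)$ with $e_i=\sum_{(i,j)\in\lambda/\mu}(|T(i,j)|-1)$. For a sequence of variables $\mathbf{y}$ and a weak composition $\alpha$, $\mathbf{y}^\alpha=\prod_k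 y_k^{\alpha_k}$. The hybrid Grothendieck polynomial is $$G_{\lambda/\mu}(\mathbf{x};\mathbf{t};\mathbf{w})=\sum_{T\in\mathrm{SVRPP}(\lambda/\mu)}\mathbf{x}^{\mathrm{ircont}(T)}\mathbf{t}^{\mathrm{ceq}(T)}\mathbf{w}^{\mathrm{ex}(T)},$$ with countably many variables $\mathbf{x}=(x_1,x_2,\ldots)$, $\mathbf{t}=(t_1,t_2,\ldots)$, $\mathbf{w}=(w_1,w_2,\ldots)$. *)

theory Defs
  imports "HOL-Library.FuncSet" "HOL-Library.Poly_Mapping" "HOL-Combinatorics.Permutations"
begin

section \<open>Partitions and skew shapes\<close>

definition is_partition :: "nat list \<Rightarrow> bool" where
  "is_partition ps \<longleftrightarrow> sorted_wrt (\<ge>) ps \<and> 0 \<notin> set ps"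

text \<open>Boxes \<open>(i, j)\<close> are in matrix coordinates, with rows and columns counted from 1; the
  \<open>i\<close>-th part of a partition is therefore the list entry with index \<open>i - 1\<close>.\<close>

definition diagram :: "nat list \<Rightarrow> (nat \<times> nat) set" where
  "diagram ps = {(i, j). 1 \<le> i \<and> i \<le> length ps \<and> 1 \<le> j \<and> j \<le> ps ! (i - 1)}"

definition skew_shape :: "nat list \<Rightarrow> nat list \<Rightarrow> (nat \<times> nat) set" where
  "skew_shape lam mu = diagram lam - diagram mu"

section \<open>Set-valued reverse plane partitions\<close>

definition set_le :: "nat set \<Rightarrow> nat set \<Rightarrow> bool" where
  "set_le A B \<longleftrightarrow> Max A \<le> Min B"

text \<open>A filling is a function on the boxes of the shape; as usual with \<open>\<rightarrow>\<^sub>E\<close> it is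
  \<open>undefined\<close> outside the shape, so that distinct functions are distinct fillings.\<close>

definition SVRPP :: "(nat \<times> nat) set \<Rightarrow> (nat \<times> nat \<Rightarrow> nat set) set" where
  "SVRPP S = {T \<in> S \<rightarrow>\<^sub>E {A. finite A \<and> A \<noteq> {} \<and> A \<subseteq> {1..}}.
     (\<forall>i j j'. (i, j) \<in> S \<and> (i, j') \<in> S \<and> j < j' \<longrightarrow> set_le (T (i, j)) (T (i, j'))) \<and>
     (\<forall>i i' j. (i, j) \<in> S \<and> (i', j) \<in> S \<and> i < i' \<longrightarrow> set_le (T (i, j)) (T (i', j)))}"

text \<open>All three statistics are sequences indexed by the positive integers; their value at the
  unused index \<open>0\<close> is \<open>0\<close> for the shapes and fillings above.\<close>

definition ircont :: "(nat \<times> nat) set \<Rightarrow> (nat \<times> nat \<Rightarrow> nat set) \<Rightarrow> nat \<Rightarrow> nat" where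
  "ircont S T k = card {j. \<exists>i. (i, j) \<in> S \<and> k \<in> T (i, j)}"

definition ceq :: "(nat \<times> nat) set \<Rightarrow> (nat \<times> nat \<Rightarrow> nat set) \<Rightarrow> nat \<Rightarrow> nat" where
  "ceq S T i = card {j. (i, j) \<in> S \<and> (i + 1, j) \<in> S \<and> Max (T (i, j)) = Min (T (i + 1, j))}"

definition ex :: "(nat \<times> nat) set \<Rightarrow> (nat \<times> nat \<Rightarrow> nat set) \<Rightarrow> nat \<Rightarrow> nat" where
  "ex S T i = (\<Sum>j\<in>{j. (i, j) \<in> S}. card (T (i, j)) - 1)"

section \<open>Formal power series in countably many variables\<close>

text \<open>A weak composition is a finitely supported exponent sequence. A formal power series is
  given by its coefficients: the value at \<open>\<alpha>\<close>, respectively \<open>(\<alpha>, \<gamma>, \<theta>)\<close>, is the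
  coefficient of \<open>x\<^sup>\<alpha>\<close>, respectively \<open>x\<^sup>\<alpha> t\<^sup>\<gamma> w\<^sup>\<theta>\<close>.\<close>

type_synonym weak_comp = "nat \<Rightarrow>\<^sub>0 nat"
type_synonym x_series = "weak_comp \<Rightarrow> int"
type_synonym xtw_series = "weak_comp \<times> weak_comp \<times> weak_comp \<Rightarrow> int"

definition xtw_monomial :: "(nat \<Rightarrow> nat) \<Rightarrow> (nat \<Rightarrow> nat) \<Rightarrow> (nat \<Rightarrow> nat) \<Rightarrow> xtw_series" where
  "xtw_monomial a c e = (\<lambda>(\<alpha>, \<gamma>, \<theta>).
     if Poly_Mapping.lookup \<alpha> = a \<and> Poly_Mapping.lookup \<gamma> = c \<and> Poly_Mapping.lookup \<theta> = e
     then 1 else 0)"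

text \<open>The sum of a possibly infinite family of series in which every monomial occurs in only
  finitely many members.\<close>

definition series_sum :: "('a \<Rightarrow> xtw_series) \<Rightarrow> 'a set \<Rightarrow> xtw_series" where
  "series_sum f A = (\<lambda>m. \<Sum>a\<in>{a \<in> A. f a m \<noteq> 0}. f a m)"

definition tw_coeff :: "xtw_series \<Rightarrow> weak_comp \<Rightarrow> weak_comp \<Rightarrow> x_series" where
  "tw_coeff F \<gamma> \<theta> = (\<lambda>\<alpha>. F (\<alpha>, \<gamma>, \<theta>))"

text \<open>Replacing each \<open>x\<^sub>k\<close> by \<open>x\<^bsub>\<sigma> k\<^esub>\<close> sends \<open>x\<^sup>\<beta>\<close> to \<open>x\<^sup>\<alpha>\<close> where
  \<open>\<alpha> \<circ> \<sigma> = \<beta>\<close>; for injective \<open>\<sigma>\<close>, \<open>Poly_Mapping.map_key \<sigma> \<alpha>\<close> is \<open>\<alpha> \<circ> \<sigma>\<close>.\<close>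

definition permute_vars :: "(nat \<Rightarrow> nat) \<Rightarrow> x_series \<Rightarrow> x_series" where
  "permute_vars \<sigma> F = (\<lambda>\<alpha>. F (Poly_Mapping.map_key \<sigma> \<alpha>))"

text \<open>Arbitrary bijections of the positive integers are allowed, not only finitary ones.\<close>

definition symmetric_series :: "x_series \<Rightarrow> bool" where
  "symmetric_series F \<longleftrightarrow> (\<forall>\<sigma>. \<sigma> permutes {1..} \<longrightarrow> permute_vars \<sigma> F = F)"

section \<open>The hybrid Grothendieck polynomial\<close>

definition hybrid_Grothendieck :: "nat list \<Rightarrow> nat list \<Rightarrow> xtw_series" where
  "hybrid_Grothendieck lam mu =
     (let S = skew_shape lam mu
      in series_sum (\<lambda>T. xtw_monomial (ircont S T) (ceq S T) (ex S T)) (SVRPP S))"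

text \<open>The remaining facts show that the definition is meaningful: the three statistics are weak
  compositions and every coefficient is a finite sum.\<close>

lemma finite_diagram: "finite (diagram ps)"
proof (rule finite_subset)
  show "diagram ps \<subseteq> {..length ps} \<times> {..sum_list ps}"
    by (auto simp: diagram_def) (metis Suc_le_eq One_nat_def Suc_pred elem_le_sum_list le_trans)
qed auto

lemma finite_skew_shape: "finite (skew_shape lam mu)"
  by (simp add: skew_shape_def finite_diagram)

lemma finite_columns:
  assumes "finite S"
  shows "finite {j. \<exists>i. (i, j) \<in> S \<and> P i j}"
  by (rule finite_subset[of _ "snd ` S"]) (use assms in force)+

lemma ircont_pos_iff:
  assumes "finite S"
  shows "ircont S T k \<noteq> 0 \<longleftrightarrow> (\<exists>b\<in>S. k \<in> T b)"
  using finite_columns[OF assms, of "\<lambda>i j. k \<in> T (i, j)"] by (auto simp: ircont_def)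

lemma statistics_finite_support:
  assumes "finite S" "T \<in> SVRPP S"
  shows "finite {k. ircont S T k \<noteq> 0}" "finite {i. ceq S T i \<noteq> 0}" "finite {i. ex S T i \<noteq> 0}"
proof -
  have "{k. ircont S T k \<noteq> 0} = (\<Union>b\<in>S. T b)"
    using ircont_pos_iff[OF assms(1)] by auto
  moreover have "finite (\<Union>b\<in>S. T b)"
    using assms by (auto simp: SVRPP_def PiE_iff)
  ultimately show "finite {k. ircont S T k \<noteq> 0}" by simp
  have "{i. ceq S T i \<noteq> 0} \<subseteq> fst ` S"
  proof
    fix i assume "i \<in> {i. ceq S T i \<noteq> 0}"
    then obtain j where "(i, j) \<in> S"
      unfolding ceq_def by (metis (mono_tags, lifting) Collect_empty_eq card.empty mem_Collect_eq)
    then show "i \<in> fst ` S" by force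
  qed
  then show "finite {i. ceq S T i \<noteq> 0}"
    using assms(1) by (meson finite_imageI finite_subset)
  have "{i. ex S T i \<noteq> 0} \<subseteq> fst ` S"
  proof
    fix i assume "i \<in> {i. ex S T i \<noteq> 0}"
    then have "{j. (i, j) \<in> S} \<noteq> {}" unfolding ex_def by (metis (mono_tags) mem_Collect_eq sum.empty)
    then show "i \<in> fst ` S" by force
  qed
  then show "finite {i. ex S T i \<noteq> 0}"
    using assms(1) by (meson finite_imageI finite_subset)
qed

lemma finite_SVRPP_ircont:
  assumes "finite S"
  shows "finite {T \<in> SVRPP S. ircont S T = Poly_Mapping.lookup \<alpha>}"
proof (rule finite_subset)
  show "{T \<in> SVRPP S. ircont S T = Poly_Mapping.lookup \<alpha>} \<subseteq> S \<rightarrow>\<^sub>E Pow (Poly_Mapping.keys \<alpha>)"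
  proof
    fix T assume T: "T \<in> {T \<in> SVRPP S. ircont S T = Poly_Mapping.lookup \<alpha>}"
    have "T b \<subseteq> Poly_Mapping.keys \<alpha>" if "b \<in> S" for b
    proof
      fix k assume "k \<in> T b"
      then have "ircont S T k \<noteq> 0" using ircont_pos_iff[OF assms] that by blast
      then show "k \<in> Poly_Mapping.keys \<alpha>" using T by (simp add: in_keys_iff)
    qed
    then show "T \<in> S \<rightarrow>\<^sub>E Pow (Poly_Mapping.keys \<alpha>)" using T by (auto simp: SVRPP_def PiE_iff)
  qed
  show "finite (S \<rightarrow>\<^sub>E Pow (Poly_Mapping.keys \<alpha>))"
    using assms by (intro finite_PiE) auto
qed

lemma hybrid_Grothendieck_coeff:
  fixes lam mu :: "nat list"
  defines "S \<equiv> skew_shape lam mu"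
  shows "hybrid_Grothendieck lam mu (\<alpha>, \<gamma>, \<theta>) =
      int (card {T \<in> SVRPP S. ircont S T = Poly_Mapping.lookup \<alpha> \<and>
        ceq S T = Poly_Mapping.lookup \<gamma> \<and> ex S T = Poly_Mapping.lookup \<theta>})"
    and "finite {T \<in> SVRPP S. ircont S T = Poly_Mapping.lookup \<alpha> \<and>
        ceq S T = Poly_Mapping.lookup \<gamma> \<and> ex S T = Poly_Mapping.lookup \<theta>}"
proof -
  let ?A = "{T \<in> SVRPP S. ircont S T = Poly_Mapping.lookup \<alpha> \<and>
        ceq S T = Poly_Mapping.lookup \<gamma> \<and> ex S T = Poly_Mapping.lookup \<theta>}"
  let ?f = "\<lambda>T. xtw_monomial (ircont S T) (ceq S T) (ex S T) (\<alpha>, \<gamma>, \<theta>)"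
  have "finite S" by (simp add: S_def finite_skew_shape)
  from finite_SVRPP_ircont[OF this, of \<alpha>] show "finite ?A"
    by (rule rev_finite_subset) auto
  have "{T \<in> SVRPP S. ?f T \<noteq> 0} = ?A"
    by (auto simp: xtw_monomial_def)
  then have "hybrid_Grothendieck lam mu (\<alpha>, \<gamma>, \<theta>) = (\<Sum>T\<in>?A. ?f T)"
    by (simp add: hybrid_Grothendieck_def series_sum_def S_def[symmetric])
  also have "\<dots> = (\<Sum>T\<in>?A. 1)"
    by (rule sum.cong) (auto simp: xtw_monomial_def)
  finally show "hybrid_Grothendieck lam mu (\<alpha>, \<gamma>, \<theta>) = int (card ?A)" by simp
qed

end

theory Submission
  imports Defs
begin

text \<open>It suffices to exchange adjacent variables \<open>x\<^sub>k\<close> and \<open>x\<^bsub>k+1\<^esub>\<close> by an involution of Bender--Knuth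
  type, extending the one of Galashin, Grinberg and Liu for reverse plane partitions. Only the
  entries \<open>k\<close> and \<open>k + 1\<close> change. In each column of the boxes meeting \<open>{k, k + 1}\<close> they form one
  of three patterns: only \<open>k\<close>, only \<open>k + 1\<close>, or \<open>k\<close> above \<open>k + 1\<close> with a separator, which is either
  a box containing both or a gap between two rows. The separators determine \<open>ceq\<close> and \<open>ex\<close>, so one
  must exchange the numbers of the two pure patterns while keeping the multiset of separators.
  Exchange the pure patterns in all columns and then repair the rows by repeatedly swapping the
  patterns of adjacent columns that are in the wrong order. This rewriting terminates and is
  locally confluent (the only overlap is ``only \<open>k + 1\<close>, separator, only \<open>k\<close>''), so it has unique
  normal forms; since exchanging the pure patterns reverses every rewriting step, the resulting
  map is an involution.\<close>

section \<open>Words of column labels\<close>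

text \<open>\<open>Sep (2 * i)\<close> stands for a box in row \<open>i\<close> containing both \<open>k\<close> and \<open>k + 1\<close>, and
  \<open>Sep (2 * i + 1)\<close> for a change from \<open>k\<close> to \<open>k + 1\<close> between the rows \<open>i\<close> and \<open>i + 1\<close>.\<close>

datatype label = One | Two | Sep nat

text \<open>The left-to-right order that a row imposes on the labels. All separators share one rank,
  so two of them are never swapped.\<close>

fun rank :: "label \<Rightarrow> nat" where
  "rank One = 0" | "rank (Sep s) = 1" | "rank Two = 2"

fun flip_label :: "label \<Rightarrow> label" where
  "flip_label One = Two" | "flip_label Two = One" | "flip_label (Sep s) = Sep s"

text \<open>The two boxes are the last one showing \<open>k\<close> and the first one showing
  \<open>k + 1\<close> under \<open>Sep s\<close>; they coincide for even \<open>s\<close>.\<close>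

fun fits :: "(nat \<times> nat) set \<Rightarrow> nat \<Rightarrow> label \<Rightarrow> bool" where
  "fits A j (Sep s) \<longleftrightarrow> (s div 2, j) \<in> A \<and> (Suc s div 2, j) \<in> A"
| "fits A j One \<longleftrightarrow> True"
| "fits A j Two \<longleftrightarrow> True"

text \<open>The \<open>fits\<close> conditions treat both columns alike, so the swap only turns the
  rank inequality around; \<open>step_flip\<close> relies on this.\<close>

definition swappable :: "(nat \<times> nat) set \<Rightarrow> (nat \<Rightarrow> label) \<Rightarrow> nat \<Rightarrow> bool" where
  "swappable A w j \<longleftrightarrow> (\<exists>i. (i, j) \<in> A \<and> (i, Suc j) \<in> A) \<and> rank (w (Suc j)) < rank (w j) \<and>
     fits A j (w j) \<and> fits A j (w (Suc j)) \<and> fits A (Suc j) (w j) \<and> fits A (Suc j) (w (Suc j))"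

definition step :: "(nat \<times> nat) set \<Rightarrow> (nat \<Rightarrow> label) \<Rightarrow> (nat \<Rightarrow> label) \<Rightarrow> bool" where
  "step A w w' \<longleftrightarrow> (\<exists>j. swappable A w j \<and> w' = w \<circ> transpose j (Suc j))"

definition normal :: "(nat \<times> nat) set \<Rightarrow> (nat \<Rightarrow> label) \<Rightarrow> bool" where
  "normal A w \<longleftrightarrow> (\<forall>j. \<not> swappable A w j)"

text \<open>Columns without boxes carry the dummy label \<open>One\<close>, so that a filling determines its word.
  The separators of a filling move weakly up from left to right; two at the same height are
  possible only between rows, because a row has at most one box containing both \<open>k\<close> and \<open>k + 1\<close>.\<close>

definition words :: "(nat \<times> nat) set \<Rightarrow> (nat \<Rightarrow> label) set" where
  "words A = {w. (\<forall>j. j \<notin> snd ` A \<longrightarrow> w j = One) \<and> (\<forall>j. fits A j (w j)) \<and>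
     (\<forall>x y s s'. x < y \<and> w x = Sep s \<and> w y = Sep s' \<longrightarrow> s' < s \<or> s' = s \<and> odd s)}"

definition flip :: "(nat \<times> nat) set \<Rightarrow> (nat \<Rightarrow> label) \<Rightarrow> nat \<Rightarrow> label" where
  "flip A w = (\<lambda>j. if j \<in> snd ` A then flip_label (w j) else w j)"

section \<open>Invariants of flips and rewriting steps\<close>

lemma flip_label_flip_label [simp]: "flip_label (flip_label l) = l"
  by (cases l) auto

lemma rank_flip_label: "rank (flip_label l) = 2 - rank l"
  by (cases l) auto

lemma rank_le: "rank l \<le> 2"
  by (cases l) auto

lemma fits_flip_label [simp]: "fits A j (flip_label l) = fits A j l"
  by (cases l) auto

lemma flip_label_eq_Sep [simp]: "flip_label l = Sep s \<longleftrightarrow> l = Sep s"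
  by (cases l) auto

lemma flip_flip [simp]: "flip A (flip A w) = w"
  by (auto simp: flip_def)

lemma flip_in_words: "w \<in> words A \<Longrightarrow> flip A w \<in> words A"
  by (auto simp: words_def flip_def)

lemma swappable_columns:
  "swappable A w j \<Longrightarrow> j \<in> snd ` A \<and> Suc j \<in> snd ` A"
  by (force simp: swappable_def)

text \<open>Separators are never swapped with each other, so their left-to-right order survives;
  \<open>swappable\<close> itself ensures that the moved labels fit.\<close>

lemma step_preserves_words:
  assumes "step A w w'" "w \<in> words A"
  shows "w' \<in> words A"
proof -
  obtain j where sw: "swappable A w j" and w': "w' = w \<circ> transpose j (Suc j)"
    using assms(1) by (auto simp: step_def)
  have out: "\<forall>x. x \<notin> snd ` A \<longrightarrow> w x = One" and fit: "\<forall>x. fits A x (w x)"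
    and seps: "\<And>x y s s'. x < y \<Longrightarrow> w x = Sep s \<Longrightarrow> w y = Sep s' \<Longrightarrow> s' < s \<or> s' = s \<and> odd s"
    using assms(2) by (auto simp: words_def)
  have "s' < s \<or> s' = s \<and> odd s"
    if "x < y" "w' x = Sep s" "w' y = Sep s'" for x y s s'
  proof -
    have "\<not> (x = j \<and> y = Suc j)"
      using that sw by (auto simp: w' swappable_def)
    then have "transpose j (Suc j) x < transpose j (Suc j) y"
      using that(1) by (auto simp: transpose_def)
    then show ?thesis
      using seps that(2,3) by (auto simp: w')
  qed
  moreover have "fits A x (w' x)" for x
    using sw fit by (auto simp: w' transpose_def swappable_def)
  moreover have "w' x = One" if "x \<notin> snd ` A" for x
  proof -
    have "x \<noteq> j" "x \<noteq> Suc j"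
      using swappable_columns[OF sw] that by auto
    then show ?thesis
      using out that by (simp add: w')
  qed
  ultimately show ?thesis
    unfolding words_def by blast
qed

text \<open>A step permutes the columns of \<open>A\<close>, so the multiset of labels is preserved;
  \<open>Q\<close> is any property to be counted.\<close>

lemma step_card:
  assumes "step A w w'"
  shows "card {j \<in> snd ` A. Q (w' j)} = card {j \<in> snd ` A. Q (w j)}"
proof -
  obtain j where sw: "swappable A w j" and w': "w' = w \<circ> transpose j (Suc j)"
    using assms by (auto simp: step_def)
  let ?t = "transpose j (Suc j)"
  have mem: "?t x \<in> snd ` A \<longleftrightarrow> x \<in> snd ` A" for x
    using swappable_columns[OF sw] by (auto simp: transpose_def)
  have "{x \<in> snd ` A. Q (w x)} = ?t ` {x \<in> snd ` A. Q (w' x)}"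
  proof (intro set_eqI iffI)
    fix x assume "x \<in> {x \<in> snd ` A. Q (w x)}"
    then have "?t x \<in> {x \<in> snd ` A. Q (w' x)}"
      using mem[of x] by (simp add: w')
    then show "x \<in> ?t ` {x \<in> snd ` A. Q (w' x)}"
      by (metis imageI transpose_involutory)
  next
    fix x assume "x \<in> ?t ` {x \<in> snd ` A. Q (w' x)}"
    then show "x \<in> {x \<in> snd ` A. Q (w x)}"
      using mem by (auto simp: w')
  qed
  moreover have "inj_on ?t X" for X
    by (metis inj_on_def transpose_involutory)
  ultimately show ?thesis
    by (simp add: card_image)
qed

text \<open>Since \<open>flip_label\<close> turns rank \<open>r\<close> into \<open>2 - r\<close>,
  flipping makes the sorted pair unsorted and vice versa, so the step runs backwards.\<close>

lemma step_flip:
  assumes "step A w w'"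
  shows "step A (flip A w') (flip A w)"
proof -
  obtain j where sw: "swappable A w j" and w': "w' = w \<circ> transpose j (Suc j)"
    using assms by (auto simp: step_def)
  have J: "j \<in> snd ` A" "Suc j \<in> snd ` A"
    using swappable_columns[OF sw] by auto
  have "swappable A (flip A w') j"
    using sw J rank_le[of "w j"] by (auto simp: swappable_def flip_def w' rank_flip_label)
  moreover have "flip A w = flip A w' \<circ> transpose j (Suc j)"
    using J by (auto simp: fun_eq_iff flip_def w' transpose_def)
  ultimately show ?thesis
    by (auto simp: step_def)
qed

section \<open>Termination, confluence and normal forms\<close>

lemma wfp_step:
  assumes "finite A"
  shows "wfP (\<lambda>w' w. step A w w')"
proof -
  let ?J = "snd ` A"
  \<comment> \<open>A step moves the larger value of \<open>2 - rank\<close> one column to the left,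
    which lowers this weighted sum.\<close>
  define m where "m w = (\<Sum>j\<in>?J. j * (2 - rank (w j)))" for w
  have "m w' < m w" if st: "step A w w'" for w w'
  proof -
    obtain j where sw: "swappable A w j" and w': "w' = w \<circ> transpose j (Suc j)"
      using st by (auto simp: step_def)
    have J: "j \<in> ?J" "Suc j \<in> ?J" and fin: "finite ?J"
      using swappable_columns[OF sw] assms by auto
    let ?K = "?J - {j} - {Suc j}"
    have split: "m v = j * (2 - rank (v j)) + (Suc j * (2 - rank (v (Suc j))) + (\<Sum>j\<in>?K. j * (2 - rank (v j))))" for v
      unfolding m_def using J fin
      by (subst sum.remove[of _ j], simp, simp, subst sum.remove[of _ "Suc j"]) auto
    have "(\<Sum>j\<in>?K. j * (2 - rank (w' j))) = (\<Sum>j\<in>?K. j * (2 - rank (w j)))"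
      by (rule sum.cong) (auto simp: w')
    moreover have "2 - rank (w j) < 2 - rank (w (Suc j))"
      using sw rank_le[of "w j"] by (auto simp: swappable_def)
    ultimately show ?thesis
      unfolding split[of w] split[of w'] by (simp add: w')
  qed
  then have "{(w', w). step A w w'} \<subseteq> measure m"
    by auto
  then show ?thesis
    unfolding wfp_def using wf_subset[OF wf_measure] by blast
qed

text \<open>Strictly decreasing ranks in three columns must be \<open>Two\<close>,
  \<open>Sep s\<close>, \<open>One\<close>. Swappability of both pairs makes \<open>Sep s\<close>
  fit in all three columns, so either first swap can be completed to \<open>One\<close>,
  \<open>Sep s\<close>, \<open>Two\<close>.\<close>

lemma local_confluence_adjacent:
  assumes "swappable A w j" "swappable A w (Suc j)"
  shows "\<exists>v. (step A)\<^sup>*\<^sup>* (w \<circ> transpose j (Suc j)) v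
    \<and> (step A)\<^sup>*\<^sup>* (w \<circ> transpose (Suc j) (Suc (Suc j))) v"
proof -
  let ?k = "Suc j" let ?l = "Suc (Suc j)"
  have r: "rank (w ?l) < rank (w ?k)" "rank (w ?k) < rank (w j)"
    using assms by (auto simp: swappable_def)
  have l: "w ?l = One" using r rank_le[of "w j"] by (cases "w ?l"; cases "w ?k"; cases "w j") auto
  have u: "w j = Two" using r rank_le[of "w j"] by (cases "w ?l"; cases "w ?k"; cases "w j") auto
  obtain s where s: "w ?k = Sep s"
    using r rank_le[of "w j"] by (cases "w ?l"; cases "w ?k"; cases "w j") auto
  define a1 a2 b1 b2 where "a1 = w \<circ> transpose j ?k" and "a2 = a1 \<circ> transpose ?k ?l"
    and "b1 = w \<circ> transpose ?k ?l" and "b2 = b1 \<circ> transpose j ?k"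
  have "swappable A a1 ?k" "swappable A a2 j" "swappable A b1 j" "swappable A b2 ?k"
    using assms unfolding swappable_def a1_def a2_def b1_def b2_def
    by (auto simp: l u s transpose_def)
  then have "step A a1 a2" "step A a2 (a2 \<circ> transpose j ?k)"
    "step A b1 b2" "step A b2 (b2 \<circ> transpose ?k ?l)"
    by (auto simp: step_def a2_def b2_def)
  moreover have "b2 \<circ> transpose ?k ?l = a2 \<circ> transpose j ?k"
    by (auto simp: fun_eq_iff transpose_def a1_def a2_def b1_def b2_def)
  ultimately show ?thesis
    unfolding a1_def[symmetric] b1_def[symmetric]
    by (metis converse_rtranclp_into_rtranclp rtranclp.rtrancl_refl)
qed

lemma local_confluence_distant:
  assumes "swappable A w j" "swappable A w k" "Suc j < k"
  shows "\<exists>v. (step A)\<^sup>*\<^sup>* (w \<circ> transpose j (Suc j)) v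
    \<and> (step A)\<^sup>*\<^sup>* (w \<circ> transpose k (Suc k)) v"
proof -
  have "swappable A (w \<circ> transpose j (Suc j)) k" "swappable A (w \<circ> transpose k (Suc k)) j"
    using assms by (auto simp: swappable_def transpose_def)
  moreover have "w \<circ> transpose j (Suc j) \<circ> transpose k (Suc k) =
      w \<circ> transpose k (Suc k) \<circ> transpose j (Suc j)"
    using assms(3) by (auto simp: fun_eq_iff transpose_def)
  ultimately show ?thesis
    by (metis r_into_rtranclp step_def)
qed

lemma local_confluence:
  assumes "step A w a" "step A w b"
  shows "\<exists>v. (step A)\<^sup>*\<^sup>* a v \<and> (step A)\<^sup>*\<^sup>* b v"
proof -
  obtain j k where j: "swappable A w j" "a = w \<circ> transpose j (Suc j)"
    and k: "swappable A w k" "b = w \<circ> transpose k (Suc k)"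
    using assms by (auto simp: step_def)
  consider "j = k" | "k = Suc j" | "j = Suc k" | "Suc j < k" | "Suc k < j"
    by linarith
  then show ?thesis
  proof cases
    case 1
    then show ?thesis using j k by auto
  next
    case 2
    then show ?thesis using j k local_confluence_adjacent by simp
  next
    case 3
    then show ?thesis using j k local_confluence_adjacent by metis
  next
    case 4
    then show ?thesis using j k local_confluence_distant by simp
  next
    case 5
    then show ?thesis using j k local_confluence_distant by metis
  qed
qed

text \<open>Newman's lemma: termination upgrades local confluence to confluence, by well-founded
  induction on the common source.\<close>

lemma newman:
  assumes wf: "wfP (\<lambda>y x. r x y)"
    and loc: "\<And>x a b. r x a \<Longrightarrow> r x b \<Longrightarrow> \<exists>v. r\<^sup>*\<^sup>* a v \<and> r\<^sup>*\<^sup>* b v"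
    and "r\<^sup>*\<^sup>* x a" "r\<^sup>*\<^sup>* x b"
  shows "\<exists>v. r\<^sup>*\<^sup>* a v \<and> r\<^sup>*\<^sup>* b v"
  using assms(3,4)
proof (induction x arbitrary: a b rule: wfp_induct_rule[OF wf])
  case (1 x)
  note IH = 1(1) and xa = 1(2) and xb = 1(3)
  from xa show ?case
  proof (cases rule: converse_rtranclpE)
    case base
    then show ?thesis using xb by blast
  next
    case a: (step a')
    from xb show ?thesis
    proof (cases rule: converse_rtranclpE)
      case base
      then show ?thesis using xa by blast
    next
      case b: (step b')
      obtain u where u: "r\<^sup>*\<^sup>* a' u" "r\<^sup>*\<^sup>* b' u"
        using loc[OF a(1) b(1)] by (elim exE conjE)
      obtain v where v: "r\<^sup>*\<^sup>* a v" "r\<^sup>*\<^sup>* u v"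
        using IH[OF a(1) a(2) u(1)] by (elim exE conjE)
      obtain z where z: "r\<^sup>*\<^sup>* v z" "r\<^sup>*\<^sup>* b z"
        using IH[OF b(1) rtranclp_trans[OF u(2) v(2)] b(2)] by (elim exE conjE)
      then show ?thesis
        using rtranclp_trans[OF v(1) z(1)] by (intro exI conjI)
    qed
  qed
qed

lemma normal_steps: "normal A w \<Longrightarrow> (step A)\<^sup>*\<^sup>* w v \<Longrightarrow> v = w"
  by (metis converse_rtranclpE normal_def step_def)

lemma normal_form_unique:
  assumes "finite A" "(step A)\<^sup>*\<^sup>* w a" "(step A)\<^sup>*\<^sup>* w b" "normal A a" "normal A b"
  shows "a = b"
proof -
  obtain v where "(step A)\<^sup>*\<^sup>* a v" "(step A)\<^sup>*\<^sup>* b v"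
    using newman[where r = "step A", OF wfp_step[OF assms(1)] _ assms(2,3)] local_confluence by metis
  then show ?thesis
    using normal_steps assms(4,5) by metis
qed

lemma normal_form_exists:
  assumes "finite A"
  shows "\<exists>v. (step A)\<^sup>*\<^sup>* w v \<and> normal A v"
proof (induction w rule: wfp_induct_rule[OF wfp_step[OF assms]])
  case (1 w)
  show ?case
  proof (cases "normal A w")
    case False
    then obtain w' where "step A w w'"
      by (auto simp: normal_def step_def)
    then show ?thesis
      using 1 by (meson converse_rtranclp_into_rtranclp)
  qed auto
qed

section \<open>Flipping followed by normalisation\<close>

definition dual :: "(nat \<times> nat) set \<Rightarrow> (nat \<Rightarrow> label) \<Rightarrow> nat \<Rightarrow> label" where
  "dual A w = (SOME v. (step A)\<^sup>*\<^sup>* (flip A w) v \<and> normal A v)"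

lemma dual_props:
  assumes "finite A"
  shows "(step A)\<^sup>*\<^sup>* (flip A w) (dual A w)" "normal A (dual A w)"
  using someI_ex[OF normal_form_exists[OF assms, of "flip A w"]] by (auto simp: dual_def)

lemma dual_in_words:
  assumes "finite A" "w \<in> words A"
  shows "dual A w \<in> words A"
  using dual_props(1)[OF assms(1)] flip_in_words[OF assms(2)]
  by (induction rule: rtranclp_induct) (auto intro: step_preserves_words)

lemma dual_card:
  assumes "finite A"
  shows "card {j \<in> snd ` A. Q (dual A w j)} = card {j \<in> snd ` A. Q (flip_label (w j))}"
proof -
  have "card {j \<in> snd ` A. Q (dual A w j)} = card {j \<in> snd ` A. Q (flip A w j)}"
    using dual_props(1)[OF assms(1)] by (induction rule: rtranclp_induct) (auto simp: step_card)
  also have "{j \<in> snd ` A. Q (flip A w j)} = {j \<in> snd ` A. Q (flip_label (w j))}"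
    by (auto simp: flip_def)
  finally show ?thesis .
qed

text \<open>Flipping the derivation from \<open>flip A w\<close> to \<open>dual A w\<close> reverses
  it into one from \<open>flip A (dual A w)\<close> to \<open>w\<close>. As \<open>w\<close> is
  normal, uniqueness of normal forms applies.\<close>

lemma dual_dual:
  assumes "finite A" "normal A w"
  shows "dual A (dual A w) = w"
proof -
  have "(step A)\<^sup>*\<^sup>* (flip A (dual A w)) (flip A (flip A w))"
    using dual_props(1)[OF assms(1)]
    by (induction rule: rtranclp_induct) (auto intro: step_flip converse_rtranclp_into_rtranclp)
  then show ?thesis
    using normal_form_unique assms dual_props by (metis flip_flip)
qed

section \<open>The involution on fillings\<close>

text \<open>Order-convexity for the componentwise order: together with finiteness, the property of a
  skew shape on which the involution rests. It passes to the active boxes.\<close>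

definition convex_boxes :: "(nat \<times> nat) set \<Rightarrow> bool" where
  "convex_boxes S \<longleftrightarrow> (\<forall>i j i' j' a b. (i, j) \<in> S \<longrightarrow> (i', j') \<in> S \<longrightarrow>
     i \<le> a \<longrightarrow> a \<le> i' \<longrightarrow> j \<le> b \<longrightarrow> b \<le> j' \<longrightarrow> (a, b) \<in> S)"

lemma convex_boxesD:
  "convex_boxes S \<Longrightarrow> (i, j) \<in> S \<Longrightarrow> (i', j') \<in> S \<Longrightarrow>
     i \<le> a \<Longrightarrow> a \<le> i' \<Longrightarrow> j \<le> b \<Longrightarrow> b \<le> j' \<Longrightarrow> (a, b) \<in> S"
  unfolding convex_boxes_def by blast

lemma diagram_down_closed:
  assumes "is_partition ps" "(i, j) \<in> diagram ps" "1 \<le> a" "a \<le> i" "1 \<le> b" "b \<le> j"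
  shows "(a, b) \<in> diagram ps"
proof -
  have i: "i \<le> length ps" "j \<le> ps ! (i - 1)"
    using assms(2) by (auto simp: diagram_def)
  have "ps ! (i - 1) \<le> ps ! (a - 1)"
  proof (cases "a = i")
    case False
    then show ?thesis
      using assms i by (intro sorted_wrt_nth_less[where P = "(\<ge>)"]) (auto simp: is_partition_def)
  qed simp
  then show ?thesis
    using assms i by (simp add: diagram_def)
qed

lemma convex_skew_shape:
  assumes "is_partition lam" "is_partition mu"
  shows "convex_boxes (skew_shape lam mu)"
  unfolding convex_boxes_def
proof (intro allI impI)
  fix i j i' j' a b
  assume *: "(i, j) \<in> skew_shape lam mu" "(i', j') \<in> skew_shape lam mu"
    "i \<le> a" "a \<le> i'" "j \<le> b" "b \<le> j'"
  then have "1 \<le> i" "1 \<le> j"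
    by (auto simp: skew_shape_def diagram_def)
  then show "(a, b) \<in> skew_shape lam mu"
    using * diagram_down_closed[OF assms(1), of i' j' a b] diagram_down_closed[OF assms(2), of a b i j]
    by (auto simp: skew_shape_def)
qed

lemma set_le_iff:
  "finite A \<Longrightarrow> A \<noteq> {} \<Longrightarrow> finite B \<Longrightarrow> B \<noteq> {} \<Longrightarrow> set_le A B \<longleftrightarrow> (\<forall>x\<in>A. \<forall>y\<in>B. x \<le> y)"
  by (auto simp: set_le_def)

lemma SVRPP_iff:
  "T \<in> SVRPP S \<longleftrightarrow> T \<in> S \<rightarrow>\<^sub>E {A. finite A \<and> A \<noteq> {} \<and> A \<subseteq> {1..}} \<and>
     (\<forall>i j j'. (i, j) \<in> S \<and> (i, j') \<in> S \<and> j < j' \<longrightarrow> (\<forall>x\<in>T (i, j). \<forall>y\<in>T (i, j'). x \<le> y)) \<and>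
     (\<forall>i i' j. (i, j) \<in> S \<and> (i', j) \<in> S \<and> i < i' \<longrightarrow> (\<forall>x\<in>T (i, j). \<forall>y\<in>T (i', j). x \<le> y))"
proof (cases "T \<in> S \<rightarrow>\<^sub>E {A. finite A \<and> A \<noteq> {} \<and> A \<subseteq> {1..}}")
  case True
  then have "finite (T b)" "T b \<noteq> {}" if "b \<in> S" for b
    using that by (auto simp: PiE_iff)
  then have "set_le (T b) (T c) \<longleftrightarrow> (\<forall>x\<in>T b. \<forall>y\<in>T c. x \<le> y)" if "b \<in> S" "c \<in> S" for b c
    using that by (simp add: set_le_iff)
  then show ?thesis
    unfolding SVRPP_def using True by simp
qed (simp add: SVRPP_def)

lemma SVRPP_nonempty: "T \<in> SVRPP S \<Longrightarrow> b \<in> S \<Longrightarrow> \<exists>x. x \<in> T b"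
  by (auto simp: SVRPP_iff PiE_iff)

lemma SVRPP_finite: "T \<in> SVRPP S \<Longrightarrow> b \<in> S \<Longrightarrow> finite (T b)"
  by (auto simp: SVRPP_iff PiE_iff)

text \<open>By convexity the corner \<open>(i, j')\<close> lies in \<open>S\<close>; any entry there
  links a row comparison to a column comparison.\<close>

lemma SVRPP_mono:
  assumes "convex_boxes S" "T \<in> SVRPP S" "(i, j) \<in> S" "(i', j') \<in> S"
    and "i \<le> i'" "j \<le> j'" "i < i' \<or> j < j'" "x \<in> T (i, j)" "y \<in> T (i', j')"
  shows "x \<le> y"
proof -
  have row: "x \<le> z" if "j < j'" "(i, j') \<in> S" "z \<in> T (i, j')" for z
    using assms that by (auto simp: SVRPP_iff)
  have col: "z \<le> y" if "i < i'" "(i, j') \<in> S" "z \<in> T (i, j')" for z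
    using assms that by (auto simp: SVRPP_iff)
  have S: "(i, j') \<in> S"
    using assms(1,3,4,5,6) by (auto intro: convex_boxesD)
  then obtain z where "z \<in> T (i, j')"
    using SVRPP_nonempty[OF assms(2)] by blast
  then show ?thesis
    using row[of y] col[of x] row[of z] col[of z] S assms(5-9)
    by (cases "i = i'"; cases "j = j'") auto
qed

section \<open>Active boxes and their encoding by words\<close>

definition active :: "nat \<Rightarrow> (nat \<times> nat) set \<Rightarrow> (nat \<times> nat \<Rightarrow> nat set) \<Rightarrow> (nat \<times> nat) set" where
  "active k S T = {b \<in> S. T b \<inter> {k, Suc k} \<noteq> {}}"

lemma active_subset: "active k S T \<subseteq> S"
  by (auto simp: active_def)

text \<open>Every entry of a box between two active boxes is squeezed between a value at least
  \<open>k\<close> and a value at most \<open>Suc k\<close>.\<close>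

lemma convex_active:
  assumes "convex_boxes S" "T \<in> SVRPP S"
  shows "convex_boxes (active k S T)"
  unfolding convex_boxes_def
proof (intro allI impI)
  fix i j i' j' a b
  assume *: "(i, j) \<in> active k S T" "(i', j') \<in> active k S T" "i \<le> a" "a \<le> i'" "j \<le> b" "b \<le> j'"
  then have S: "(i, j) \<in> S" "(i', j') \<in> S"
    by (auto simp: active_def)
  with * assms(1) have ab: "(a, b) \<in> S"
    by (auto intro: convex_boxesD)
  show "(a, b) \<in> active k S T"
  proof (cases "(a, b) = (i, j) \<or> (a, b) = (i', j')")
    case False
    obtain x y where x: "x \<in> T (i, j)" "k \<le> x" and y: "y \<in> T (i', j')" "y \<le> Suc k"
      using * by (fastforce simp: active_def)
    obtain z where z: "z \<in> T (a, b)"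
      using SVRPP_nonempty[OF assms(2) ab] by blast
    have "x \<le> z" "z \<le> y"
      using SVRPP_mono[OF assms S(1) ab _ _ _ x(1) z] SVRPP_mono[OF assms ab S(2) _ _ _ z y(1)]
        False * by auto
    then have "z = k \<or> z = Suc k"
      using x y by linarith
    then show ?thesis
      using z ab by (auto simp: active_def)
  qed (use * in auto)
qed

text \<open>The trace on \<open>{k, Suc k}\<close> of a box in row \<open>i\<close> of a column with
  the given label. As \<open>Sep\<close> counts half-rows, both tests succeed exactly for
  \<open>s = 2 * i\<close>.\<close>

fun mid :: "nat \<Rightarrow> nat \<Rightarrow> label \<Rightarrow> nat set" where
  "mid k i One = {k}"
| "mid k i Two = {Suc k}"
| "mid k i (Sep s) = (if 2 * i \<le> s then {k} else {}) \<union> (if s \<le> 2 * i then {Suc k} else {})"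

lemma mid_nonempty: "mid k i l \<noteq> {}"
  by (cases l) auto

lemma mid_subset: "mid k i l \<subseteq> {k, Suc k}"
  by (cases l) auto

text \<open>No \<open>k\<close> may occur below a \<open>Suc k\<close> in a column, so the traces
  change at most once: there is no \<open>Suc k\<close>, no \<open>k\<close>, one box with both, or
  a change between two rows.\<close>

lemma label_exists:
  fixes k :: nat
  assumes cv: "convex_boxes S" and T: "T \<in> SVRPP S" and fin: "finite S"
  defines "A \<equiv> active k S T"
  shows "\<exists>l. fits A j l \<and> (\<forall>i. (i, j) \<in> A \<longrightarrow> T (i, j) \<inter> {k, Suc k} = mid k i l)"
proof -
  have AS: "A \<subseteq> S" and inA: "\<And>b. b \<in> A \<Longrightarrow> k \<in> T b \<or> Suc k \<in> T b"
    by (auto simp: A_def active_def)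
  have mono: "x \<le> y" if "(i, j) \<in> A" "(i', j) \<in> A" "i < i'" "x \<in> T (i, j)" "y \<in> T (i', j)" for i i' x y
    using SVRPP_mono[OF cv T, of i j i' j] that AS by auto
  consider "\<forall>i. (i, j) \<in> A \<longrightarrow> Suc k \<notin> T (i, j)" | "\<forall>i. (i, j) \<in> A \<longrightarrow> k \<notin> T (i, j)"
    | i where "(i, j) \<in> A" "k \<in> T (i, j)" "Suc k \<in> T (i, j)"
    | i i' where "(i, j) \<in> A" "k \<in> T (i, j)" "(i', j) \<in> A" "Suc k \<in> T (i', j)"
      "\<forall>i. (i, j) \<in> A \<longrightarrow> k \<notin> T (i, j) \<or> Suc k \<notin> T (i, j)"
    by blast
  then show ?thesis
  proof cases
    case 1
    then have "\<forall>i. (i, j) \<in> A \<longrightarrow> T (i, j) \<inter> {k, Suc k} = mid k i One"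
      using inA by auto
    then show ?thesis by (intro exI[of _ One]) simp
  next
    case 2
    then have "\<forall>i. (i, j) \<in> A \<longrightarrow> T (i, j) \<inter> {k, Suc k} = mid k i Two"
      using inA by auto
    then show ?thesis by (intro exI[of _ Two]) simp
  next
    case (3 i)
    have "T (r, j) \<inter> {k, Suc k} = mid k r (Sep (2 * i))" if r: "(r, j) \<in> A" for r
    proof (cases r i rule: linorder_cases)
      case less
      then show ?thesis
        using mono[OF r 3(1) less, of "Suc k" k] 3 inA[OF r] by auto
    next
      case equal
      then show ?thesis using 3 by auto
    next
      case greater
      then show ?thesis
        using mono[OF 3(1) r greater, of "Suc k" k] 3 inA[OF r] by auto
    qed
    then show ?thesis using 3(1) by (intro exI[of _ "Sep (2 * i)"]) simp
  next
    case (4 a a')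
    \<comment> \<open>The separator sits just below the lowest row containing \<open>k\<close>;
      convexity makes the following row active, as \<open>fits\<close> demands.\<close>
    define R where "R = {i. (i, j) \<in> A \<and> k \<in> T (i, j)}"
    have "R \<subseteq> fst ` S" using AS by (force simp: R_def)
    then have R: "finite R" "a \<in> R"
      using fin 4 by (auto simp: R_def intro: finite_subset)
    define i where "i = Max R"
    have i: "(i, j) \<in> A" "k \<in> T (i, j)"
      using Max_in[of R] R by (auto simp: i_def R_def)
    have max: "k \<notin> T (r, j)" if "(r, j) \<in> A" "i < r" for r
    proof
      assume "k \<in> T (r, j)"
      then have "r \<le> i" using that R(1) by (auto simp: i_def R_def)
      then show False using that by simp
    qed
    have "i < a'"
      using mono[OF 4(3) i(1), of "Suc k" k] 4 i by (cases a' i rule: linorder_cases) auto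
    then have "(Suc i, j) \<in> A"
      using convex_boxesD[OF convex_active[OF cv T], of i j k a' j "Suc i" j] i(1) 4(3) by (simp add: A_def)
    moreover have "T (r, j) \<inter> {k, Suc k} = mid k r (Sep (Suc (2 * i)))" if r: "(r, j) \<in> A" for r
    proof (cases r i rule: linorder_cases)
      case less
      then show ?thesis
        using mono[OF r i(1) less, of "Suc k" k] i inA[OF r] by auto
    next
      case equal
      then show ?thesis using 4 i by auto
    next
      case greater
      then show ?thesis
        using max[OF r] inA[OF r] by auto
    qed
    ultimately show ?thesis using i(1) by (intro exI[of _ "Sep (Suc (2 * i))"]) simp
  qed
qed

text \<open>A fitting separator is pinned down by its two boxes, one showing \<open>k\<close> and
  one showing \<open>Suc k\<close>. The box \<open>(r, j)\<close> tells \<open>One\<close> from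
  \<open>Two\<close>.\<close>

lemma label_unique:
  assumes "fits A j l" "fits A j l'" "(r, j) \<in> A"
    and "\<And>i. (i, j) \<in> A \<Longrightarrow> mid k i l = mid k i l'"
  shows "l = l'"
proof -
  have pure: False if l: "fits A j (Sep s)" "l' = One \<or> l' = Two"
    "\<And>i. (i, j) \<in> A \<Longrightarrow> mid k i (Sep s) = mid k i l'" for s l'
  proof -
    have *: "(s div 2, j) \<in> A" "(Suc s div 2, j) \<in> A"
      using l(1) by auto
    have "k \<in> mid k (s div 2) l'"
      unfolding l(3)[OF *(1), symmetric] by simp
    moreover have "Suc k \<in> mid k (Suc s div 2) l'"
      unfolding l(3)[OF *(2), symmetric] by simp
    ultimately show False
      using l(2) by auto
  qed
  have le: "s' \<le> s" if l: "fits A j (Sep s)"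
    "\<And>i. (i, j) \<in> A \<Longrightarrow> mid k i (Sep s) = mid k i (Sep s')" for s s'
  proof (rule ccontr)
    assume "\<not> s' \<le> s"
    moreover have "mid k (Suc s div 2) (Sep s) = mid k (Suc s div 2) (Sep s')"
      using l(1) by (intro l(2)) simp
    ultimately show False by (auto split: if_splits)
  qed
  have eq: "mid k i l = mid k i l'" "mid k i l' = mid k i l" if "(i, j) \<in> A" for i
    using assms(4)[OF that] by auto
  show ?thesis
  proof (cases l)
    case (Sep s)
    show ?thesis
    proof (cases l')
      case (Sep s')
      have "s' \<le> s" "s \<le> s'"
        using le[of s s'] le[of s' s] assms(1,2) eq unfolding Sep \<open>l = Sep s\<close> by blast+
      then show ?thesis using Sep \<open>l = Sep s\<close> by simp
    qed (use pure[of s l'] assms(1) eq(1) Sep in blast)+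
  next
    case One
    show ?thesis
    proof (cases l')
      case (Sep s')
      then show ?thesis using pure[of s' l] assms(2) eq(2) One by blast
    qed (use eq(1)[OF assms(3)] One in auto)
  next
    case Two
    show ?thesis
    proof (cases l')
      case (Sep s')
      then show ?thesis using pure[of s' l] assms(2) eq(2) Two by blast
    qed (use eq(1)[OF assms(3)] Two in auto)
  qed
qed

definition encodes :: "nat \<Rightarrow> (nat \<times> nat) set \<Rightarrow> (nat \<Rightarrow> label) \<Rightarrow> (nat \<times> nat \<Rightarrow> nat set) \<Rightarrow> bool" where
  "encodes k A w T \<longleftrightarrow> (\<forall>i j. (i, j) \<in> A \<longrightarrow> T (i, j) \<inter> {k, Suc k} = mid k i (w j))"

lemma encodesD: "encodes k A w T \<Longrightarrow> (i, j) \<in> A \<Longrightarrow> x \<in> mid k i (w j) \<longleftrightarrow> x \<in> T (i, j) \<and> (x = k \<or> x = Suc k)"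
  unfolding encodes_def by blast

lemma encodes_unique:
  assumes "w \<in> words A" "w' \<in> words A" "encodes k A w T" "encodes k A w' T"
  shows "w = w'"
proof
  fix j
  show "w j = w' j"
  proof (cases "j \<in> snd ` A")
    case True
    then obtain r where "(r, j) \<in> A" by auto
    then show ?thesis
      using assms by (intro label_unique[of A j "w j" "w' j" r k]) (auto simp: words_def encodes_def)
  next
    case False
    then show ?thesis using assms by (auto simp: words_def)
  qed
qed

text \<open>A violation of the separator order, or a swappable pair, would put a
  \<open>Suc k\<close> strictly left of and weakly above a \<open>k\<close>, against the
  monotonicity of \<open>T\<close>.\<close>

lemma encodes_exists:
  fixes k :: nat
  assumes cv: "convex_boxes S" and T: "T \<in> SVRPP S" and fin: "finite S"
  defines "A \<equiv> active k S T"
  shows "\<exists>w \<in> words A. normal A w \<and> encodes k A w T"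
proof -
  have "\<exists>l. fits A j l \<and> (\<forall>i. (i, j) \<in> A \<longrightarrow> T (i, j) \<inter> {k, Suc k} = mid k i l) \<and> (j \<notin> snd ` A \<longrightarrow> l = One)" for j
  proof (cases "j \<in> snd ` A")
    case True
    then show ?thesis using label_exists[OF cv T fin] by (auto simp: A_def)
  next
    case False
    then show ?thesis by (intro exI[of _ One]) force
  qed
  then obtain w where w: "\<And>j. fits A j (w j)"
    "\<And>i j. (i, j) \<in> A \<Longrightarrow> T (i, j) \<inter> {k, Suc k} = mid k i (w j)"
    "\<And>j. j \<notin> snd ` A \<Longrightarrow> w j = One"
    by metis
  have enc: "encodes k A w T"
    using w(2) by (simp add: encodes_def)
  have mono: False if "(i, j) \<in> A" "(i', j') \<in> A" "i \<le> i'" "j < j'"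
    "Suc k \<in> mid k i (w j)" "k \<in> mid k i' (w j')" for i j i' j'
    using SVRPP_mono[OF cv T, of i j i' j' "Suc k" k] that encodesD[OF enc]
    by (auto simp: A_def active_def)
  have "s' < s \<or> s' = s \<and> odd s" if "x < y" "w x = Sep s" "w y = Sep s'" for x y s s'
  proof (rule ccontr)
    assume *: "\<not> ?thesis"
    \<comment> \<open>\<open>Suc s div 2\<close> is the first row with \<open>Suc k\<close> in
      column \<open>x\<close>, and \<open>s' div 2\<close> the last row with \<open>k\<close> in
      column \<open>y\<close>.\<close>
    have "Suc s div 2 \<le> s' div 2"
      using * by (cases "s = s'") (auto elim!: evenE)
    moreover have "(Suc s div 2, x) \<in> A" "(s' div 2, y) \<in> A"
      using w(1)[of x] w(1)[of y] that by auto
    moreover have "Suc k \<in> mid k (Suc s div 2) (w x)" "k \<in> mid k (s' div 2) (w y)"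
      using that by auto
    ultimately show False
      using mono that(1) by blast
  qed
  then have "w \<in> words A"
    using w by (auto simp: words_def)
  moreover have "normal A w"
    unfolding normal_def
  proof (intro allI notI)
    fix j assume sw: "swappable A w j"
    then obtain r where r: "(r, j) \<in> A" "(r, Suc j) \<in> A"
      by (auto simp: swappable_def)
    \<comment> \<open>The witness is \<open>Suc s div 2\<close> for a separator on the left,
      \<open>s div 2\<close> for one on the right, and the shared row \<open>r\<close> for
      \<open>Two\<close> before \<open>One\<close>.\<close>
    have "\<exists>i. (i, j) \<in> A \<and> (i, Suc j) \<in> A \<and> Suc k \<in> mid k i (w j) \<and> k \<in> mid k i (w (Suc j))"
    proof (cases "w j")
      case One
      then show ?thesis using sw by (auto simp: swappable_def)
    next
      case (Sep s)
      then have "w (Suc j) = One"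
        using sw by (cases "w (Suc j)") (auto simp: swappable_def)
      then show ?thesis
        using sw Sep by (intro exI[of _ "Suc s div 2"]) (auto simp: swappable_def)
    next
      case Two
      show ?thesis
      proof (cases "w (Suc j)")
        case One
        then show ?thesis using r Two by auto
      next
        case (Sep s)
        then show ?thesis
          using sw Two by (intro exI[of _ "s div 2"]) (auto simp: swappable_def)
      next
        case Two': Two
        then show ?thesis using sw Two by (auto simp: swappable_def)
      qed
    qed
    then show False using mono by (meson le_refl lessI)
  qed
  ultimately show ?thesis using enc by blast
qed

section \<open>Refilling the active boxes\<close>

definition refill :: "nat \<Rightarrow> (nat \<times> nat) set \<Rightarrow> (nat \<Rightarrow> label) \<Rightarrow> (nat \<times> nat \<Rightarrow> nat set) \<Rightarrow> nat \<times> nat \<Rightarrow> nat set" where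
  "refill k A w T = (\<lambda>b. if b \<in> A then T b - {k, Suc k} \<union> mid k (fst b) (w (snd b)) else T b)"

lemma mem_refill_outside:
  "x \<noteq> k \<Longrightarrow> x \<noteq> Suc k \<Longrightarrow> x \<in> refill k A w T b \<longleftrightarrow> x \<in> T b"
  using mid_subset[of k "fst b" "w (snd b)"] by (auto simp: refill_def)

lemma mem_refill_inside:
  "b \<in> A \<Longrightarrow> x = k \<or> x = Suc k \<Longrightarrow> x \<in> refill k A w T b \<longleftrightarrow> x \<in> mid k (fst b) (w (snd b))"
  by (auto simp: refill_def)

lemma encodes_refill: "encodes k A w (refill k A w T)"
  unfolding encodes_def refill_def using mid_subset[of k] by auto

text \<open>Every \<open>mid\<close> is nonempty, so active boxes stay active; hence the involution
  uses the same \<open>A\<close> in both directions.\<close>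

lemma active_refill:
  "active k S (refill k (active k S T) w T) = active k S T"
proof (rule set_eqI)
  fix b
  have "mid k (fst b) (w (snd b)) \<inter> {k, Suc k} \<noteq> {}"
    using mid_subset mid_nonempty by (metis inf.absorb1)
  then show "b \<in> active k S (refill k (active k S T) w T) \<longleftrightarrow> b \<in> active k S T"
    by (auto simp: active_def refill_def)
qed

lemma refill_encoded: "encodes k A w T \<Longrightarrow> refill k A w T = T"
proof
  fix b
  assume "encodes k A w T"
  then show "refill k A w T b = T b"
    using encodesD[of k A w T "fst b" "snd b"] mid_subset[of k "fst b" "w (snd b)"]
    by (auto simp: refill_def)
qed

lemma refill_refill: "refill k A w (refill k A w' T) = refill k A w T"
proof
  fix b
  show "refill k A w (refill k A w' T) b = refill k A w T b"
    using mid_subset[of k "fst b" "w' (snd b)"] by (auto simp: refill_def)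
qed

text \<open>Two separators in conflict contradict the order condition in \<open>words\<close>.
  Otherwise the ranks decrease and convexity makes both labels fit in both columns, so the pair
  would be swappable.\<close>

lemma normal_adjacent:
  assumes cv: "convex_boxes A" and w: "w \<in> words A" "normal A w"
    and A: "(i, j) \<in> A" "(i, Suc j) \<in> A"
  shows "\<not> (Suc k \<in> mid k i (w j) \<and> k \<in> mid k i (w (Suc j)))"
proof
  assume *: "Suc k \<in> mid k i (w j) \<and> k \<in> mid k i (w (Suc j))"
  have fit: "\<And>j. fits A j (w j)"
    and seps: "\<And>x y s s'. x < y \<Longrightarrow> w x = Sep s \<Longrightarrow> w y = Sep s' \<Longrightarrow> s' < s \<or> s' = s \<and> odd s"
    using w(1) by (auto simp: words_def)
  \<comment> \<open>For \<open>s \<le> 2 * i\<close> both boxes of the separator lie in rows up to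
    \<open>i\<close>, so the box \<open>(i, Suc j)\<close> lets convexity carry them one column to
    the right; \<open>fits_left\<close> is the mirror image.\<close>
  have fits_right: "fits A (Suc j) (Sep s)" if "fits A j (Sep s)" "s \<le> 2 * i" for s
    using that convex_boxesD[OF cv _ A(2), of "s div 2" j "s div 2" "Suc j"]
      convex_boxesD[OF cv _ A(2), of "Suc s div 2" j "Suc s div 2" "Suc j"] by auto
  have fits_left: "fits A j (Sep s)" if "fits A (Suc j) (Sep s)" "2 * i \<le> s" for s
    using that convex_boxesD[OF cv A(1), of "s div 2" "Suc j" "s div 2" j]
      convex_boxesD[OF cv A(1), of "Suc s div 2" "Suc j" "Suc s div 2" j] by auto
  have "\<not> (w j = Sep s \<and> w (Suc j) = Sep s')" for s s'
  proof
    assume S: "w j = Sep s \<and> w (Suc j) = Sep s'"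
    then have "s \<le> 2 * i" "2 * i \<le> s'"
      using * by (auto split: if_splits)
    moreover have "s' < s \<or> s' = s \<and> odd s"
      using S seps by blast
    ultimately have "s = 2 * i" "odd s" by linarith+
    then show False by simp
  qed
  then have "rank (w (Suc j)) < rank (w j)"
    using * by (cases "w j"; cases "w (Suc j)") auto
  moreover have "fits A (Suc j) (w j)"
    using fit[of j] * fits_right by (cases "w j") (auto split: if_splits)
  moreover have "fits A j (w (Suc j))"
    using fit[of "Suc j"] * fits_left by (cases "w (Suc j)") (auto split: if_splits)
  ultimately have "swappable A w j"
    using fit A by (auto simp: swappable_def)
  then show False using w(2) by (simp add: normal_def)
qed

text \<open>The box before the last one shows \<open>k\<close> or \<open>Suc k\<close>: the former
  contradicts the induction hypothesis, the latter the adjacent case.\<close>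

lemma normal_row:
  assumes cv: "convex_boxes A" and w: "w \<in> words A" "normal A w"
    and A: "(i, j) \<in> A" "(i, j + Suc d) \<in> A"
  shows "\<not> (Suc k \<in> mid k i (w j) \<and> k \<in> mid k i (w (j + Suc d)))"
  using A(2)
proof (induction d)
  case 0
  then show ?case
    using normal_adjacent[OF cv w A(1)] by simp
next
  case (Suc d)
  have "(i, j + Suc d) \<in> A"
    using convex_boxesD[OF cv A(1) Suc.prems] by simp
  then show ?case
    using Suc normal_adjacent[OF cv w, of i "j + Suc d"] mid_nonempty[of k i "w (j + Suc d)"]
      mid_subset[of k i "w (j + Suc d)"] by auto
qed

lemma mid_column: "i < i' \<Longrightarrow> \<not> (Suc k \<in> mid k i l \<and> k \<in> mid k i' l)"
  by (cases l) auto

text \<open>A single comparison serving rows and columns alike; the arrangement of \<open>k\<close>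
  and \<open>Suc k\<close> enters only through the hypothesis \<open>mid\<close>.\<close>

lemma refill_le:
  assumes x: "x \<in> refill k A w T b" and y: "y \<in> refill k A w T c"
    and T: "\<And>x y. x \<in> T b \<Longrightarrow> y \<in> T c \<Longrightarrow> x \<le> y"
    and A: "\<And>b. b \<in> A \<Longrightarrow> k \<in> T b \<or> Suc k \<in> T b"
    and mid: "b \<in> A \<Longrightarrow> c \<in> A \<Longrightarrow> \<not> (Suc k \<in> mid k (fst b) (w (snd b)) \<and> k \<in> mid k (fst c) (w (snd c)))"
    and out: "b \<notin> A \<Longrightarrow> T b \<inter> {k, Suc k} = {}" "c \<notin> A \<Longrightarrow> T c \<inter> {k, Suc k} = {}"
  shows "x \<le> y"
proof -
  have inA: "b \<in> A" if "x \<in> {k, Suc k}"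
    using that x out(1) by (auto simp: refill_def split: if_splits)
  have inA': "c \<in> A" if "y \<in> {k, Suc k}"
    using that y out(2) by (auto simp: refill_def split: if_splits)
  show ?thesis
  proof (cases "x \<in> {k, Suc k}"; cases "y \<in> {k, Suc k}")
    assume xy: "x \<in> {k, Suc k}" "y \<in> {k, Suc k}"
    then show ?thesis
      using mid[OF inA inA'] x y inA inA' by (auto simp: mem_refill_inside)
  next
    \<comment> \<open>The active box \<open>b\<close> has an old entry in \<open>{k, Suc k}\<close>
      that is at most \<open>y\<close>; as \<open>y\<close> is neither value, it exceeds
      both.\<close>
    assume xy: "x \<in> {k, Suc k}" "y \<notin> {k, Suc k}"
    then have "y \<in> T c" using y by (simp add: mem_refill_outside)
    then show ?thesis
      using T[of k y] T[of "Suc k" y] A[OF inA] xy by fastforce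
  next
    assume xy: "x \<notin> {k, Suc k}" "y \<in> {k, Suc k}"
    then have "x \<in> T b" using x by (simp add: mem_refill_outside)
    then show ?thesis
      using T[of x k] T[of x "Suc k"] A[OF inA'] xy by fastforce
  next
    assume "x \<notin> {k, Suc k}" "y \<notin> {k, Suc k}"
    then show ?thesis
      using T x y by (simp add: mem_refill_outside)
  qed
qed

lemma refill_in_SVRPP:
  fixes k :: nat
  assumes cv: "convex_boxes S" and T: "T \<in> SVRPP S" and "1 \<le> k"
  defines "A \<equiv> active k S T"
  assumes w: "w \<in> words A" "normal A w"
  shows "refill k A w T \<in> SVRPP S"
proof -
  let ?T = "refill k A w T"
  have AS: "A \<subseteq> S" and inA: "\<And>b. b \<in> A \<Longrightarrow> k \<in> T b \<or> Suc k \<in> T b"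
    and out: "\<And>b. b \<in> S \<Longrightarrow> b \<notin> A \<Longrightarrow> T b \<inter> {k, Suc k} = {}"
    by (auto simp: A_def active_def)
  have cA: "convex_boxes A"
    using convex_active[OF cv T] by (simp add: A_def)
  note order = refill_le[where A = A and T = T and w = w and k = k, OF _ _ _ inA]
  have "x \<le> y" if "(i, j) \<in> S" "(i, j') \<in> S" "j < j'" "x \<in> ?T (i, j)" "y \<in> ?T (i, j')" for i j j' x y
  proof (rule order[OF that(4,5)])
    show "x \<le> y" if "x \<in> T (i, j)" "y \<in> T (i, j')" for x y
      using SVRPP_mono[OF cv T, of i j i j' x y] that \<open>(i, j) \<in> S\<close> \<open>(i, j') \<in> S\<close> \<open>j < j'\<close> by simp
    obtain d where d: "j' = j + Suc d"
      using less_imp_Suc_add[OF \<open>j < j'\<close>] by auto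
    show "\<not> (Suc k \<in> mid k (fst (i, j)) (w (snd (i, j))) \<and> k \<in> mid k (fst (i, j')) (w (snd (i, j'))))"
      if "(i, j) \<in> A" "(i, j') \<in> A"
      using normal_row[OF cA w, of i j d k] that d by simp
  qed (use out that in auto)
  moreover have "x \<le> y" if "(i, j) \<in> S" "(i', j) \<in> S" "i < i'" "x \<in> ?T (i, j)" "y \<in> ?T (i', j)" for i i' j x y
  proof (rule order[OF that(4,5)])
    show "x \<le> y" if "x \<in> T (i, j)" "y \<in> T (i', j)" for x y
      using SVRPP_mono[OF cv T, of i j i' j x y] that \<open>(i, j) \<in> S\<close> \<open>(i', j) \<in> S\<close> \<open>i < i'\<close> by simp
    show "\<not> (Suc k \<in> mid k (fst (i, j)) (w (snd (i, j))) \<and> k \<in> mid k (fst (i', j)) (w (snd (i', j))))"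
      using mid_column[OF \<open>i < i'\<close>] by simp
  qed (use out that in auto)
  moreover have "?T \<in> S \<rightarrow>\<^sub>E {A. finite A \<and> A \<noteq> {} \<and> A \<subseteq> {1..}}"
  proof (rule PiE_I)
    fix b assume "b \<in> S"
    then have *: "finite (T b)" "T b \<noteq> {}" "T b \<subseteq> {1..}"
      using T by (auto simp: SVRPP_iff PiE_iff)
    have "finite (mid k i l)" "mid k i l \<subseteq> {1..}" for i l
      using mid_subset[of k i l] \<open>1 \<le> k\<close> by (auto intro: finite_subset)
    then show "?T b \<in> {A. finite A \<and> A \<noteq> {} \<and> A \<subseteq> {1..}}"
      using * mid_nonempty by (auto simp: refill_def)
  next
    fix b assume "b \<notin> S"
    then show "?T b = undefined"
      using T AS PiE_arb[of T S _ b] by (auto simp: refill_def SVRPP_def)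
  qed
  ultimately show ?thesis
    unfolding SVRPP_iff by blast
qed

section \<open>The statistics in terms of words\<close>

lemma ircont_encoded:
  assumes "w \<in> words A" "encodes k A w T" "A = active k S T"
  shows "ircont S T k = card {j \<in> snd ` A. w j \<noteq> Two}"
    and "ircont S T (Suc k) = card {j \<in> snd ` A. w j \<noteq> One}"
proof -
  have fit: "\<And>j. fits A j (w j)"
    using assms(1) by (auto simp: words_def)
  have A: "(i, j) \<in> S \<and> x \<in> T (i, j) \<longleftrightarrow> (i, j) \<in> A \<and> x \<in> mid k i (w j)" if "x \<in> {k, Suc k}" for i j x
    using that encodesD[OF assms(2), of i j x] by (auto simp: assms(3) active_def)
  \<comment> \<open>For a separator, \<open>fits\<close> supplies the active box in row
    \<open>s div 2\<close> that shows \<open>k\<close>.\<close>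
  have lo: "(\<exists>i. (i, j) \<in> A \<and> k \<in> mid k i (w j)) \<longleftrightarrow> j \<in> snd ` A \<and> w j \<noteq> Two" for j
  proof (cases "w j")
    case (Sep s)
    then have "(s div 2, j) \<in> A \<and> k \<in> mid k (s div 2) (w j)"
      using fit[of j] by auto
    then show ?thesis using Sep by force
  qed force+
  have hi: "(\<exists>i. (i, j) \<in> A \<and> Suc k \<in> mid k i (w j)) \<longleftrightarrow> j \<in> snd ` A \<and> w j \<noteq> One" for j
  proof (cases "w j")
    case (Sep s)
    then have "(Suc s div 2, j) \<in> A \<and> Suc k \<in> mid k (Suc s div 2) (w j)"
      using fit[of j] by auto
    then show ?thesis using Sep by force
  qed force+
  show "ircont S T k = card {j \<in> snd ` A. w j \<noteq> Two}"
    unfolding ircont_def using A[of k] lo by simp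
  show "ircont S T (Suc k) = card {j \<in> snd ` A. w j \<noteq> One}"
    unfolding ircont_def using A[of "Suc k"] hi by simp
qed

lemma ircont_refill:
  "m \<noteq> k \<Longrightarrow> m \<noteq> Suc k \<Longrightarrow> ircont S (refill k A w T) m = ircont S T m"
  by (simp add: ircont_def mem_refill_outside)

text \<open>The trace of an active box has size two at an even separator and size one elsewhere. The
  sum ignores how \<open>k\<close> and \<open>Suc k\<close> are distributed over the active
  boxes.\<close>

lemma ex_encoded:
  fixes k :: nat
  assumes fin: "finite S" and T: "T \<in> SVRPP S" and w: "w \<in> words A" "encodes k A w T"
    and A: "A = active k S T"
  shows "ex S T i = (\<Sum>j | (i, j) \<in> S. if (i, j) \<in> A then card (T (i, j) - {k, Suc k}) else card (T (i, j)) - 1)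
     + card {j \<in> snd ` A. w j = Sep (2 * i)}"
proof -
  let ?R = "{j. (i, j) \<in> S}"
  let ?base = "\<lambda>j. if (i, j) \<in> A then card (T (i, j) - {k, Suc k}) else card (T (i, j)) - 1"
  let ?D = "{j \<in> snd ` A. w j = Sep (2 * i)}"
  have fit: "\<And>j. fits A j (w j)"
    using w(1) by (auto simp: words_def)
  have R: "finite ?R"
    by (rule finite_subset[of _ "snd ` S"]) (use fin in force)+
  have D: "(i, j) \<in> A" if "w j = Sep (2 * i)" for j
    using fit[of j] that by simp
  then have DR: "?D \<subseteq> ?R"
    using active_subset A by blast
  have "card (T (i, j)) - 1 = ?base j + (if j \<in> ?D then 1 else 0)" if "(i, j) \<in> S" for j
  proof (cases "(i, j) \<in> A")
    case True
    have "card (T (i, j)) = card (T (i, j) - {k, Suc k}) + card (T (i, j) \<inter> {k, Suc k})"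
      using SVRPP_finite[OF T that] card_Diff_subset_Int[of "T (i, j)" "{k, Suc k}"]
        card_mono[of "T (i, j)" "T (i, j) \<inter> {k, Suc k}"] by simp
    also have "T (i, j) \<inter> {k, Suc k} = mid k i (w j)"
      using w(2) True by (simp add: encodes_def)
    also have "card (mid k i (w j)) = 1 + (if w j = Sep (2 * i) then 1 else 0)"
      by (cases "w j") auto
    finally show ?thesis using True by force
  next
    case False
    then show ?thesis using D by auto
  qed
  then have "ex S T i = (\<Sum>j\<in>?R. ?base j + (if j \<in> ?D then 1 else 0))"
    unfolding ex_def by (intro sum.cong) auto
  also have "\<dots> = (\<Sum>j\<in>?R. ?base j) + card (?R \<inter> ?D)"
    using R by (simp add: sum.distrib sum.If_cases)
  also have "?R \<inter> ?D = ?D"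
    using DR by blast
  finally show ?thesis .
qed

lemma Max_eq_Min_iff:
  assumes "finite A" "A \<noteq> {}" "finite B" "B \<noteq> {}" "\<And>x y. x \<in> A \<Longrightarrow> y \<in> B \<Longrightarrow> x \<le> (y::nat)"
  shows "Max A = Min B \<longleftrightarrow> A \<inter> B \<noteq> {}"
proof
  assume "Max A = Min B"
  then show "A \<inter> B \<noteq> {}"
    using Max_in[OF assms(1,2)] Min_in[OF assms(3,4)] by auto
next
  assume "A \<inter> B \<noteq> {}"
  then obtain m where "m \<in> A" "m \<in> B" by blast
  then have "Min B \<le> Max A"
    using assms by (meson Max_ge Min_le le_trans)
  moreover have "Max A \<le> Min B"
    using assms by simp
  ultimately show "Max A = Min B" by simp
qed

text \<open>Equality of \<open>Max\<close> and \<open>Min\<close> amounts to a common entry. Two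
  active boxes, one directly above the other, lack one exactly at an odd separator; in any other
  pair no common entry is \<open>k\<close> or \<open>Suc k\<close>. The additive form avoids
  subtraction on \<open>nat\<close>.\<close>

lemma ceq_encoded:
  fixes k :: nat
  assumes cv: "convex_boxes S" and fin: "finite S" and T: "T \<in> SVRPP S"
    and w: "w \<in> words A" "encodes k A w T" and A: "A = active k S T"
  shows "ceq S T i + card {j \<in> snd ` A. w j = Sep (Suc (2 * i))} =
     card {j. (i, j) \<in> S \<and> (Suc i, j) \<in> S \<and> \<not> ((i, j) \<in> A \<and> (Suc i, j) \<in> A) \<and>
       T (i, j) \<inter> T (Suc i, j) - {k, Suc k} \<noteq> {}}
     + card {j. (i, j) \<in> A \<and> (Suc i, j) \<in> A}"
proof -
  let ?E = "{j. (i, j) \<in> S \<and> (Suc i, j) \<in> S \<and> \<not> ((i, j) \<in> A \<and> (Suc i, j) \<in> A) \<and>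
       T (i, j) \<inter> T (Suc i, j) - {k, Suc k} \<noteq> {}}"
  let ?B = "{j. (i, j) \<in> A \<and> (Suc i, j) \<in> A}"
  let ?D = "{j \<in> snd ` A. w j = Sep (Suc (2 * i))}"
  have fit: "\<And>j. fits A j (w j)"
    using w(1) by (auto simp: words_def)
  have AS: "A \<subseteq> S" using A active_subset by blast
  have finj: "finite {j. (r, j) \<in> S}" for r
    by (rule finite_subset[of _ "snd ` S"]) (use fin in force)+
  have "?D \<subseteq> ?B"
  proof
    fix j assume "j \<in> ?D"
    then show "j \<in> ?B" using fit[of j] by simp
  qed
  moreover have finE: "finite ?E" and finB: "finite ?B"
    by (rule finite_subset[OF _ finj[of i]]; use AS in auto)+
  ultimately have B: "card (?B - ?D) + card ?D = card ?B"
    using card_mono[of ?B ?D] by (simp add: card_Diff_subset finite_subset)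
  have outside: "T (i, j) \<inter> T (Suc i, j) \<inter> {k, Suc k} = {}"
    if "(i, j) \<in> S" "(Suc i, j) \<in> S" "\<not> ((i, j) \<in> A \<and> (Suc i, j) \<in> A)" for j
    using that by (auto simp: A active_def)
  have inside: "T (i, j) \<inter> T (Suc i, j) \<noteq> {} \<longleftrightarrow> w j \<noteq> Sep (Suc (2 * i))"
    if j: "(i, j) \<in> A" "(Suc i, j) \<in> A" for j
  proof -
    have S: "(i, j) \<in> S" "(Suc i, j) \<in> S"
      using j AS by auto
    obtain a z where a: "a \<in> T (i, j)" "k \<le> a" and z: "z \<in> T (Suc i, j)" "z \<le> Suc k"
      using j by (fastforce simp: A active_def)
    \<comment> \<open>As an entry of the lower box \<open>m\<close> is at least \<open>a\<close>,
      and as an entry of the upper box at most \<open>z\<close>.\<close>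
    have "m \<in> {k, Suc k}" if "m \<in> T (i, j) \<inter> T (Suc i, j)" for m
    proof -
      have "a \<le> m" "m \<le> z"
        using SVRPP_mono[OF cv T S] that a z by auto
      then have "k \<le> m" "m \<le> Suc k"
        using a z by linarith+
      then show ?thesis by auto
    qed
    then have "T (i, j) \<inter> T (Suc i, j) = (T (i, j) \<inter> {k, Suc k}) \<inter> (T (Suc i, j) \<inter> {k, Suc k})"
      by blast
    also have "\<dots> = mid k i (w j) \<inter> mid k (Suc i) (w j)"
      using w(2) j by (simp add: encodes_def)
    also have "\<dots> \<noteq> {} \<longleftrightarrow> w j \<noteq> Sep (Suc (2 * i))"
      by (cases "w j") auto
    finally show ?thesis .
  qed
  have "Max (T (i, j)) = Min (T (Suc i, j)) \<longleftrightarrow> T (i, j) \<inter> T (Suc i, j) \<noteq> {}"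
    if "(i, j) \<in> S" "(Suc i, j) \<in> S" for j
    using that SVRPP_finite[OF T] SVRPP_nonempty[OF T] SVRPP_mono[OF cv T that]
    by (intro Max_eq_Min_iff) fastforce+
  then have "{j. (i, j) \<in> S \<and> (Suc i, j) \<in> S \<and> Max (T (i, j)) = Min (T (Suc i, j))} =
      {j. (i, j) \<in> S \<and> (Suc i, j) \<in> S \<and> T (i, j) \<inter> T (Suc i, j) \<noteq> {}}"
    by blast
  also have "\<dots> = ?E \<union> (?B - ?D)"
  proof (rule set_eqI)
    fix j
    show "j \<in> {j. (i, j) \<in> S \<and> (Suc i, j) \<in> S \<and> T (i, j) \<inter> T (Suc i, j) \<noteq> {}} \<longleftrightarrow> j \<in> ?E \<union> (?B - ?D)"
    proof (cases "(i, j) \<in> A \<and> (Suc i, j) \<in> A")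
      case True
      then have "j \<in> snd ` A" by force
      then show ?thesis using True inside[of j] AS by auto
    next
      case False
      then show ?thesis using outside[of j] by blast
    qed
  qed
  finally have "ceq S T i = card (?E \<union> (?B - ?D))"
    by (simp add: ceq_def)
  also have "\<dots> = card ?E + card (?B - ?D)"
    using finE finB by (intro card_Un_disjoint) auto
  finally show ?thesis using B by simp
qed

section \<open>The involution and its effect on the statistics\<close>

definition bender_knuth :: "nat \<Rightarrow> (nat \<times> nat) set \<Rightarrow> (nat \<times> nat \<Rightarrow> nat set) \<Rightarrow> nat \<times> nat \<Rightarrow> nat set" where
  "bender_knuth k S T = (let A = active k S T in
     refill k A (dual A (THE w. w \<in> words A \<and> encodes k A w T)) T)"

lemma bender_knuth_eq:
  assumes "w \<in> words (active k S T)" "encodes k (active k S T) w T"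
  shows "bender_knuth k S T = refill k (active k S T) (dual (active k S T) w) T"
proof -
  have "(THE w. w \<in> words (active k S T) \<and> encodes k (active k S T) w T) = w"
    using assms encodes_unique by blast
  then show ?thesis by (simp add: bender_knuth_def Let_def)
qed

lemma bender_knuth:
  assumes cv: "convex_boxes S" and fin: "finite S" and T: "T \<in> SVRPP S" and "1 \<le> k"
  shows "bender_knuth k S T \<in> SVRPP S"
    and "bender_knuth k S (bender_knuth k S T) = T"
    and "ircont S (bender_knuth k S T) = ircont S T \<circ> transpose k (Suc k)"
    and "ex S (bender_knuth k S T) = ex S T"
    and "ceq S (bender_knuth k S T) = ceq S T"
proof -
  define A where "A = active k S T"
  have A: "finite A"
    unfolding A_def using active_subset fin by (rule finite_subset)
  obtain w where w: "w \<in> words A" "normal A w" and enc: "encodes k A w T"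
    using encodes_exists[OF cv T fin] by (auto simp: A_def)
  define v where "v = dual A w"
  have v: "v \<in> words A" "normal A v"
    using dual_in_words[OF A w(1)] dual_props(2)[OF A] by (auto simp: v_def)
  define T' where "T' = refill k A v T"
  have bk: "bender_knuth k S T = T'"
    using bender_knuth_eq[of w k S T] w enc by (simp add: A_def v_def T'_def)
  have T': "T' \<in> SVRPP S"
    using refill_in_SVRPP[OF cv T \<open>1 \<le> k\<close>] v by (simp add: A_def T'_def)
  \<comment> \<open>Both fillings are thus described by words over one set \<open>A\<close>, which
    is what makes \<open>dual_dual\<close> applicable.\<close>
  have A': "A = active k S T'"
    using active_refill[of k S T v] by (simp add: A_def T'_def)
  have enc': "encodes k A v T'"
    by (simp add: T'_def encodes_refill)
  have "bender_knuth k S T' = refill k A (dual A v) T'"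
    using bender_knuth_eq[of v k S T'] v enc' A' by simp
  also have "\<dots> = T"
    using enc w(2) by (simp add: v_def dual_dual[OF A] T'_def refill_refill refill_encoded)
  finally show "bender_knuth k S (bender_knuth k S T) = T"
    using bk by simp
  show "bender_knuth k S T \<in> SVRPP S"
    using bk T' by simp
  \<comment> \<open>For suitable \<open>Q\<close> this exchanges the counts behind
    \<open>ircont\<close> at \<open>k\<close> and \<open>Suc k\<close>, and preserves the count of
    each separator, hence \<open>ex\<close> and \<open>ceq\<close>.\<close>
  note card = dual_card[OF A, of _ w, folded v_def]
  have flip_One_Two: "flip_label l = One \<longleftrightarrow> l = Two" "flip_label l = Two \<longleftrightarrow> l = One" for l
    by (cases l; simp)+
  show "ircont S (bender_knuth k S T) = ircont S T \<circ> transpose k (Suc k)"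
  proof
    fix m
    consider "m = k" | "m = Suc k" | "m \<noteq> k" "m \<noteq> Suc k" by blast
    then show "ircont S (bender_knuth k S T) m = (ircont S T \<circ> transpose k (Suc k)) m"
    proof cases
      case 1
      then show ?thesis
        using ircont_encoded[OF w(1) enc A_def] ircont_encoded[OF v(1) enc' A'] card[of "\<lambda>l. l \<noteq> Two"]
        by (simp add: bk flip_One_Two)
    next
      case 2
      then show ?thesis
        using ircont_encoded[OF w(1) enc A_def] ircont_encoded[OF v(1) enc' A'] card[of "\<lambda>l. l \<noteq> One"]
        by (simp add: bk flip_One_Two)
    next
      case 3
      then show ?thesis by (simp add: bk T'_def ircont_refill)
    qed
  qed
  \<comment> \<open>This and \<open>inn\<close> show that the terms in \<open>ex_encoded\<close> and
    \<open>ceq_encoded\<close> not referring to the word agree for \<open>T\<close> and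
    \<open>T'\<close>.\<close>
  have out: "T' b = T b" if "b \<notin> A" for b
    using that by (simp add: T'_def refill_def)
  have inn: "T' b - {k, Suc k} = T b - {k, Suc k}" for b
    using mid_subset[of k "fst b" "v (snd b)"] by (auto simp: T'_def refill_def)
  show "ex S (bender_knuth k S T) = ex S T"
  proof
    fix i
    have "ex S T' i = ex S T i"
      using card[of "\<lambda>l. l = Sep (2 * i)"]
      unfolding ex_encoded[OF fin T w(1) enc A_def, of i] ex_encoded[OF fin T' v(1) enc' A', of i]
      by (simp add: inn out cong: if_cong)
    then show "ex S (bender_knuth k S T) i = ex S T i" by (simp add: bk)
  qed
  show "ceq S (bender_knuth k S T) = ceq S T"
  proof
    fix i
    have "T' b \<inter> T' c - {k, Suc k} = T b \<inter> T c - {k, Suc k}" for b c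
      using inn[of b] inn[of c] by blast
    then have "ceq S T' i = ceq S T i"
      using card[of "\<lambda>l. l = Sep (Suc (2 * i))"]
        ceq_encoded[OF cv fin T w(1) enc A_def, of i] ceq_encoded[OF cv fin T' v(1) enc' A', of i]
      by simp
    then show "ceq S (bender_knuth k S T) i = ceq S T i" by (simp add: bk)
  qed
qed

section \<open>Symmetry\<close>

definition count_SVRPP :: "(nat \<times> nat) set \<Rightarrow> (nat \<Rightarrow> nat) \<Rightarrow> (nat \<Rightarrow> nat) \<Rightarrow> (nat \<Rightarrow> nat) \<Rightarrow> nat" where
  "count_SVRPP S a c e = card {T \<in> SVRPP S. ircont S T = a \<and> ceq S T = c \<and> ex S T = e}"

lemma count_SVRPP_adjacent:
  assumes "convex_boxes S" "finite S" "1 \<le> k"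
  shows "count_SVRPP S (a \<circ> transpose k (Suc k)) c e = count_SVRPP S a c e"
  unfolding count_SVRPP_def
proof (rule bij_betw_same_card[OF bij_betw_byWitness[where f' = "bender_knuth k S"]])
  let ?F = "\<lambda>a. {T \<in> SVRPP S. ircont S T = a \<and> ceq S T = c \<and> ex S T = e}"
  let ?t = "transpose k (Suc k)"
  note bk = bender_knuth[OF assms(1,2) _ assms(3)]
  show "\<forall>T\<in>?F (a \<circ> ?t). bender_knuth k S (bender_knuth k S T) = T"
    "\<forall>T\<in>?F a. bender_knuth k S (bender_knuth k S T) = T"
    using bk by auto
  have "a \<circ> ?t \<circ> ?t = a" by (simp add: comp_assoc)
  then show "bender_knuth k S ` ?F (a \<circ> ?t) \<subseteq> ?F a" "bender_knuth k S ` ?F a \<subseteq> ?F (a \<circ> ?t)"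
    using bk by auto
qed

text \<open>Induction on \<open>l\<close>: conjugating \<open>transpose k l\<close> by the adjacent
  transposition of \<open>l\<close> and \<open>Suc l\<close> gives
  \<open>transpose k (Suc l)\<close>.\<close>

lemma count_SVRPP_transpose:
  assumes "convex_boxes S" "finite S" "1 \<le> k" "k < l"
  shows "count_SVRPP S (a \<circ> transpose k l) c e = count_SVRPP S a c e"
  using assms(4)
proof (induction l arbitrary: a)
  case (Suc l)
  show ?case
  proof (cases "k = l")
    case True
    then show ?thesis using count_SVRPP_adjacent[OF assms(1-3)] by blast
  next
    case False
    let ?t = "transpose l (Suc l)"
    have "transpose k (Suc l) = ?t \<circ> transpose k l \<circ> ?t"
      using Suc.prems False by (auto simp: fun_eq_iff transpose_def)
    then have "a \<circ> transpose k (Suc l) = a \<circ> ?t \<circ> transpose k l \<circ> ?t"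
      by (simp add: comp_assoc)
    moreover have "count_SVRPP S (b \<circ> ?t) c e = count_SVRPP S b c e" for b
      using count_SVRPP_adjacent[OF assms(1,2)] assms(3) Suc.prems by simp
    moreover have "count_SVRPP S (b \<circ> transpose k l) c e = count_SVRPP S b c e" for b
      using Suc.prems False by (intro Suc.IH) simp
    ultimately show ?thesis by (simp only:)
  qed
qed simp

lemma count_SVRPP_finite_permutes:
  assumes "convex_boxes S" "finite S" "finite F" "F \<subseteq> {1..}" "p permutes F"
  shows "count_SVRPP S (a \<circ> p) c e = count_SVRPP S a c e"
  using assms(3,5)
proof (induction arbitrary: a rule: permutes_rev_induct)
  case (swap k l p)
  have "count_SVRPP S (b \<circ> transpose k l) c e = count_SVRPP S b c e" for b
  proof (cases k l rule: linorder_cases)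
    case less
    then show ?thesis
      using count_SVRPP_transpose[OF assms(1,2)] swap.hyps(1) assms(4) by auto
  next
    case greater
    then show ?thesis
      using count_SVRPP_transpose[OF assms(1,2), of l k b] swap.hyps(2) assms(4)
      by (auto simp: transpose_commute)
  qed (use swap.hyps(3) in simp)
  then show ?case
    using swap.IH[of a] by (simp only: flip: comp_assoc)
qed simp

text \<open>Only the finitely many points that \<open>\<sigma>\<close> sends into the support of
  \<open>a\<close> matter, which reduces arbitrary bijections to finite permutations and so to
  transpositions.\<close>

lemma comp_permutation_finite:
  fixes a :: "nat \<Rightarrow> nat"
  assumes "finite {x. a x \<noteq> 0}" "\<sigma> permutes U"
  obtains F p where "finite F" "F \<subseteq> U" "p permutes F" "a \<circ> \<sigma> = a \<circ> p"
proof -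
  define K where "K = {x \<in> U. a x \<noteq> 0}"
  define L where "L = {x \<in> U. \<sigma> x \<in> K}"
  have bij: "bij \<sigma>"
    using assms(2) by (rule permutes_bij)
  have K: "finite K"
    using assms(1) by (auto simp: K_def intro: finite_subset)
  have LK: "bij_betw \<sigma> L K"
  proof (rule bij_betw_imageI)
    show "inj_on \<sigma> L"
      using bij by (meson bij_is_inj inj_on_subset subset_UNIV)
    have "x \<in> \<sigma> ` L" if "x \<in> K" for x
    proof
      show "x = \<sigma> (inv \<sigma> x)"
        using bij by (simp add: bij_is_surj surj_f_inv_f)
      have "inv \<sigma> x \<in> U"
        using that permutes_in_image[OF permutes_inv[OF assms(2)], of x] by (simp add: K_def)
      then show "inv \<sigma> x \<in> L"
        using that \<open>x = \<sigma> (inv \<sigma> x)\<close> by (simp add: L_def)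
    qed
    then show "\<sigma> ` L = K" by (auto simp: L_def)
  qed
  define F where "F = K \<union> L"
  have L: "finite L" using LK K bij_betw_finite by blast
  then have F: "finite F" "F \<subseteq> U" using K by (auto simp: F_def K_def L_def)
  \<comment> \<open>Any bijection \<open>h\<close> between these complements extends
    \<open>\<sigma>\<close> on \<open>L\<close> to a permutation of \<open>F\<close>.\<close>
  have "card (F - L) = card (F - K)"
    using K L bij_betw_same_card[OF LK] by (simp add: card_Diff_subset F_def)
  then obtain h where h: "bij_betw h (F - L) (F - K)"
    using F finite_same_card_bij by (metis finite_Diff)
  define p where "p x = (if x \<in> L then \<sigma> x else if x \<in> F then h x else x)" for x
  have "bij_betw p (L \<union> (F - L)) (K \<union> (F - K))"
  proof (rule bij_betw_combine)
    show "bij_betw p L K"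
      using LK by (rule bij_betw_cong[THEN iffD1, rotated]) (simp add: p_def)
    show "bij_betw p (F - L) (F - K)"
      using h by (rule bij_betw_cong[THEN iffD1, rotated]) (simp add: p_def)
  qed auto
  moreover have "L \<union> (F - L) = F" "K \<union> (F - K) = F"
    by (auto simp: F_def)
  ultimately have "bij_betw p F F" by simp
  then have p: "p permutes F"
    by (rule bij_imp_permutes) (auto simp: p_def F_def)
  \<comment> \<open>Outside \<open>U\<close> both maps fix \<open>x\<close>, even where
    \<open>a\<close> is nonzero. Inside \<open>U\<close> but off \<open>L\<close> both images lie in
    \<open>U\<close> outside \<open>K\<close>, where \<open>a\<close> vanishes.\<close>
  have "a (\<sigma> x) = a (p x)" for x
  proof (cases "x \<in> U")
    case False
    then have "\<sigma> x = x" "p x = x"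
      using assms(2) F(2) by (auto simp: permutes_not_in p_def L_def)
    then show ?thesis by simp
  next
    case True
    show ?thesis
    proof (cases "x \<in> L")
      case False
      have "p x \<in> U"
        using permutes_in_image[OF p, of x] permutes_not_in[OF p, of x] F(2) True by (cases "x \<in> F") auto
      moreover have "p x \<notin> K"
        using False bij_betwE[OF h] by (cases "x \<in> F") (auto simp: p_def F_def)
      moreover have "\<sigma> x \<in> U" "\<sigma> x \<notin> K"
        using True False permutes_in_image[OF assms(2)] by (auto simp: L_def)
      ultimately show ?thesis by (simp add: K_def)
    qed (simp add: p_def)
  qed
  then show thesis
    using that F p by (auto simp: fun_eq_iff)
qed

theorem theorem1p2:
  fixes lam mu :: "nat list"
  assumes "is_partition lam"
    and "is_partition mu"
    and "diagram mu \<subseteq> diagram lam"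
  shows "\<forall>\<gamma> \<theta>. symmetric_series (tw_coeff (hybrid_Grothendieck lam mu) \<gamma> \<theta>)"
  unfolding symmetric_series_def permute_vars_def tw_coeff_def
proof (intro allI impI ext)
  fix \<gamma> \<theta> \<alpha> :: weak_comp and \<sigma> :: "nat \<Rightarrow> nat"
  assume \<sigma>: "\<sigma> permutes {1..}"
  let ?S = "skew_shape lam mu"
  have coeff: "hybrid_Grothendieck lam mu (\<beta>, \<gamma>, \<theta>) = int (count_SVRPP ?S (Poly_Mapping.lookup \<beta>)
      (Poly_Mapping.lookup \<gamma>) (Poly_Mapping.lookup \<theta>))" for \<beta>
    by (simp add: hybrid_Grothendieck_coeff count_SVRPP_def)
  have lookup: "Poly_Mapping.lookup (Poly_Mapping.map_key \<sigma> \<alpha>) = Poly_Mapping.lookup \<alpha> \<circ> \<sigma>"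
    using map_key.rep_eq[OF permutes_inj[OF \<sigma>]] by (auto simp: fun_eq_iff)
  obtain F p where "finite F" "F \<subseteq> {1..}" "p permutes F"
    and p: "Poly_Mapping.lookup \<alpha> \<circ> \<sigma> = Poly_Mapping.lookup \<alpha> \<circ> p"
    using comp_permutation_finite[OF finite_lookup \<sigma>] .
  then show "hybrid_Grothendieck lam mu (Poly_Mapping.map_key \<sigma> \<alpha>, \<gamma>, \<theta>) =
      hybrid_Grothendieck lam mu (\<alpha>, \<gamma>, \<theta>)"
    unfolding coeff lookup p
    using count_SVRPP_finite_permutes[OF convex_skew_shape[OF assms(1,2)] finite_skew_shape] by simp
qed

end
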